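(* Let $G$ be a word-representable graph and let $v$ be a vertex of $G$. Then there exists a semi-transitive orientation of $G$ in which $v$ is a source. Likewise, there exists a semi-transitive orientation of $G$ in which $v$ is a sink.
   Context: Graphs are finite, simple and undirected. Two distinct letters $x$ and $y$ alternate in a word $w$ if after deleting from $w$ all letters except the copies of $x$ and $y$ one obtains either a word $xyxy\cdots$ (of even or odd length) or a word $yxyx\cdots$ (of even or odd length). A graph $G=(V,E)$ is word-representable if there exists a (finite) word $w$ over the alphabet $V$, in which each letter of $V$ occurs at least once, such that for all distinct $x,y\in V$, the letters $x$ and $y$ alternate in $w$ if and only if $xy\in E$. An orientation of a graph assigns a direction to each edge. An orientation is semi-transitive if it is acyclic (contains no directed cycles) and for any directed path $v_0\rightarrow v_1\rightarrow\cdots\rightarrow v_k$ either there is no edge between $v_0$ and $v_k$, or $v_i\rightarrow v_j$ is an edge for all $0\le i<j\le k$. A vertex is a source in an orientation if all edges incident with it are oriented away from it, and a sink if all edges incident with it are oriented towards it. *)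

theory Defs
  imports "Graph_Theory.Graph_Theory"
begin

text \<open>
  A finite simple undirected graph is a \<^locale>\<open>pair_graph\<close>: a finite, loop-free symmetric digraph
  without parallel arcs, in which an edge \<open>xy\<close> is the pair of arcs \<open>(x, y)\<close> and \<open>(y, x)\<close>.
\<close>

definition alternating_word :: "'a \<Rightarrow> 'a \<Rightarrow> nat \<Rightarrow> 'a list" where
  "alternating_word x y n = map (\<lambda>i. if even i then x else y) [0..<n]"

definition alternate :: "'a list \<Rightarrow> 'a \<Rightarrow> 'a \<Rightarrow> bool" where
  "alternate w x y \<longleftrightarrow>
     (\<exists>n. filter (\<lambda>z. z = x \<or> z = y) w = alternating_word x y n \<or>
          filter (\<lambda>z. z = x \<or> z = y) w = alternating_word y x n)"

definition word_representable :: "'a pair_pre_digraph \<Rightarrow> bool" where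
  "word_representable G \<longleftrightarrow>
     (\<exists>w. set w = pverts G \<and>
          (\<forall>x\<in>pverts G. \<forall>y\<in>pverts G. x \<noteq> y \<longrightarrow> (alternate w x y \<longleftrightarrow> (x, y) \<in> parcs G)))"

definition orientation_of :: "'a pair_pre_digraph \<Rightarrow> 'a pair_pre_digraph \<Rightarrow> bool" where
  "orientation_of G D \<longleftrightarrow>
     pverts D = pverts G \<and>
     parcs D \<union> (parcs D)\<inverse> = parcs G \<and>
     parcs D \<inter> (parcs D)\<inverse> = {}"

text \<open>
  The vertex list \<open>p\<close> below is \<open>v\<^sub>0, \<dots>, v\<^sub>k\<close> with \<open>k = length p - 1\<close>; it is nonempty, because
  \<^const>\<open>vwalk\<close> excludes the empty list.
\<close>

definition semi_transitive :: "'a pair_pre_digraph \<Rightarrow> bool" where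
  "semi_transitive D \<longleftrightarrow>
     (\<nexists>c. pre_digraph.cycle (with_proj D) c) \<and>
     (\<forall>p. vpath p (with_proj D) \<longrightarrow>
        ((hd p, last p) \<notin> parcs D \<and> (last p, hd p) \<notin> parcs D) \<or>
        (\<forall>i j. i < j \<and> j < length p \<longrightarrow> (p ! i, p ! j) \<in> parcs D))"

definition source :: "'a pair_pre_digraph \<Rightarrow> 'a \<Rightarrow> bool" where
  "source D v \<longleftrightarrow> (\<forall>(x, y)\<in>parcs D. x = v \<or> y = v \<longrightarrow> x = v)"

definition sink :: "'a pair_pre_digraph \<Rightarrow> 'a \<Rightarrow> bool" where
  "sink D v \<longleftrightarrow> (\<forall>(x, y)\<in>parcs D. x = v \<or> y = v \<longrightarrow> y = v)"

end

theory Submission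
  imports Defs
begin

text \<open>
  Let \<open>c\<^sub>t(x)\<close> be the number of occurrences of \<open>x\<close> in the prefix of length \<open>t\<close> of a word
  representing \<open>G\<close>. Two letters alternate iff \<open>c\<^sub>t(x) - c\<^sub>t(y)\<close> varies by at most \<open>1\<close> as \<open>t\<close> varies,
  a condition that does not change when \<open>c\<^sub>t\<close> is replaced by \<open>g\<^sub>t = c\<^sub>t - c\<^sub>s\<close> for a fixed time \<open>s\<close>.
  Orienting an edge from \<open>x\<close> to \<open>y\<close> when \<open>g\<^sub>t(y) \<le> g\<^sub>t(x)\<close> for all \<open>t\<close> is semi-transitive: along a
  directed path the functions \<open>g\<close> decrease, and if those of the two ends differ by at most \<open>1\<close>, so do
  those of any two vertices in between. Choosing \<open>s\<close> just before (after) an occurrence of \<open>v\<close>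
  makes \<open>v\<close> a source (sink).
\<close>

lemma alternating_word_0 [simp]: "alternating_word x y 0 = []"
  by (simp add: alternating_word_def)

lemma alternating_word_Suc [simp]:
  "alternating_word x y (Suc n) = x # alternating_word y x n"
  by (auto simp: alternating_word_def upt_conv_Cons map_Suc_upt[symmetric] simp del: upt_Suc)

text \<open>Induction on \<open>w\<close> with \<open>x\<close> and \<open>y\<close> generalized:
  after a leading \<open>x\<close> the two letters swap roles, as c(y) \<le> c(x) \<le> c(y) + 1 for
  the whole word becomes c(x) \<le> c(y) \<le> c(x) + 1 for the tail. A leading \<open>y\<close>
  violates the bounds at \<open>t = 1\<close>.\<close>

lemma filter_eq_alternating_word_iff:
  assumes "x \<noteq> y"
  shows "(\<exists>n. filter (\<lambda>z. z = x \<or> z = y) w = alternating_word x y n) \<longleftrightarrow>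
    (\<forall>t. count_list (take t w) y \<le> count_list (take t w) x \<and>
         count_list (take t w) x \<le> Suc (count_list (take t w) y))"
  using assms
proof (induction w arbitrary: x y)
  case Nil
  have "[] = alternating_word x y 0" by simp
  then show ?case by (auto intro: exI[of _ 0])
next
  case (Cons z w)
  have all_nat: "(\<forall>t. P t) \<longleftrightarrow> P 0 \<and> (\<forall>t. P (Suc t))" for P :: "nat \<Rightarrow> bool"
    by (auto intro: nat.induct[of P])
  have ex_nat: "(\<exists>n. P n) \<longleftrightarrow> P 0 \<or> (\<exists>n. P (Suc n))" for P :: "nat \<Rightarrow> bool"
    using all_nat[of "\<lambda>n. \<not> P n"] by blast
  consider "z = x" | "z = y" | "z \<noteq> x" "z \<noteq> y" by blast
  then show ?case
  proof cases
    case 1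
    have "(\<exists>n. filter (\<lambda>u. u = x \<or> u = y) (z # w) = alternating_word x y n) \<longleftrightarrow>
      (\<exists>n. filter (\<lambda>u. u = y \<or> u = x) w = alternating_word y x n)"
      unfolding ex_nat[of "\<lambda>n. _ = alternating_word x y n"] using 1 by (simp add: disj_commute)
    then show ?thesis
      unfolding all_nat[of "\<lambda>t. count_list (take t (z # w)) y \<le> _ t \<and> _ t"]
      using 1 Cons.IH[of y x] Cons.prems by auto
  next
    case 2
    have "\<not> (\<exists>n. filter (\<lambda>u. u = x \<or> u = y) (z # w) = alternating_word x y n)"
      unfolding ex_nat[of "\<lambda>n. _ = alternating_word x y n"] using 2 Cons.prems by simp
    moreover have "\<not> count_list (take 1 (z # w)) y \<le> count_list (take 1 (z # w)) x"
      using 2 Cons.prems by simp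
    ultimately show ?thesis by blast
  next
    case 3
    then show ?thesis
      unfolding all_nat[of "\<lambda>t. count_list (take t (z # w)) y \<le> _ t \<and> _ t"]
      using Cons.IH[of x y] Cons.prems by auto
  qed
qed

definition count_shift :: "'a list \<Rightarrow> nat \<Rightarrow> nat \<Rightarrow> 'a \<Rightarrow> int" where
  "count_shift w s t x = int (count_list (take t w) x) - int (count_list (take s w) x)"

lemma alternate_iff_count_shift:
  assumes "x \<noteq> y"
  shows "alternate w x y \<longleftrightarrow>
    (\<forall>t. 0 \<le> count_shift w s t x - count_shift w s t y \<and> count_shift w s t x - count_shift w s t y \<le> 1) \<or>
    (\<forall>t. 0 \<le> count_shift w s t y - count_shift w s t x \<and> count_shift w s t y - count_shift w s t x \<le> 1)"
proof -
  define d where "d t = int (count_list (take t w) x) - int (count_list (take t w) y)" for t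
  have "d 0 = 0" by (simp add: d_def)
  have "alternate w x y \<longleftrightarrow> (\<forall>t. 0 \<le> d t \<and> d t \<le> 1) \<or> (\<forall>t. - 1 \<le> d t \<and> d t \<le> 0)"
    using filter_eq_alternating_word_iff[OF assms, of w]
      filter_eq_alternating_word_iff[OF assms[symmetric], of w]
    unfolding alternate_def ex_disj_distrib d_def
    by (simp add: disj_commute) (smt (verit, best) of_nat_Suc of_nat_le_iff)
  \<comment> \<open>Both sides say that the range of \<open>d\<close> has width at most 1:
    \<open>d 0 = 0\<close> and \<open>d s\<close> are values of \<open>d\<close>, so either one is
    the least or the greatest value.\<close>
  also have "\<dots> \<longleftrightarrow> (\<forall>t. 0 \<le> d t - d s \<and> d t - d s \<le> 1) \<or> (\<forall>t. 0 \<le> d s - d t \<and> d s - d t \<le> 1)"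
    using \<open>d 0 = 0\<close> by (smt (verit))
  finally show ?thesis by (simp add: d_def count_shift_def algebra_simps)
qed

text \<open>Reading an occurrence of \<open>x\<close> raises the count of \<open>x\<close> alone.
  This makes the pointwise order on the counts antisymmetric.\<close>

lemma inj_on_count_shift: "inj_on (\<lambda>x t. count_shift w s t x) (set w)"
proof (rule inj_onI)
  fix x y assume x: "x \<in> set w" and eq: "(\<lambda>t. count_shift w s t x) = (\<lambda>t. count_shift w s t y)"
  obtain i where i: "i < length w" "w ! i = x"
    using x by (auto simp: in_set_conv_nth)
  have "count_shift w s (Suc i) x = count_shift w s i x + 1"
    using i by (simp add: take_Suc_conv_app_nth count_shift_def)
  moreover have "count_shift w s (Suc i) y = count_shift w s i y" if "x \<noteq> y"
    using i that by (simp add: take_Suc_conv_app_nth count_shift_def)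
  ultimately show "x = y"
    using fun_cong[OF eq, of i] fun_cong[OF eq, of "Suc i"] by linarith
qed

lemma nth_Suc_in_vwalk_arcs:
  "Suc n < length p \<Longrightarrow> (p ! n, p ! Suc n) \<in> set (vwalk_arcs p)"
proof (induction p arbitrary: n rule: vwalk_arcs.induct)
  case (3 x y xs)
  then show ?case by (cases n) auto
qed auto

definition dominance_digraph :: "'a set \<Rightarrow> ('i \<Rightarrow> 'a \<Rightarrow> int) \<Rightarrow> 'a pair_pre_digraph" where
  "dominance_digraph V g = \<lparr>pverts = V,
     parcs = {(x, y). x \<in> V \<and> y \<in> V \<and> x \<noteq> y \<and> (\<forall>t. 0 \<le> g t x - g t y \<and> g t x - g t y \<le> 1)}\<rparr>"

lemma semi_transitive_dominance_digraph:
  assumes inj: "inj_on (\<lambda>x t. g t x) V"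
  shows "semi_transitive (dominance_digraph V g)" (is "semi_transitive ?D")
proof -
  \<comment> \<open>Bounded differences are not transitive; dropping the bound 1 leaves a strict
    partial order that contains all arcs.\<close>
  let ?R = "{(x, y). x \<in> V \<and> y \<in> V \<and> x \<noteq> y \<and> (\<forall>t. g t y \<le> g t x)}"
  have eqI: "x = y" if "x \<in> V" "y \<in> V" "\<forall>t. g t y \<le> g t x" "\<forall>t. g t x \<le> g t y" for x y
    by (rule inj_onD[OF inj]) (use that in \<open>auto intro: order.antisym\<close>)
  have trans_R: "trans ?R"
  proof (rule transI, clarify, intro conjI allI)
    fix x y z assume xyz: "y \<in> V" "x \<in> V" "x \<noteq> y" "\<forall>t. g t y \<le> g t x"
      "z \<in> V" "y \<noteq> z" "\<forall>t. g t z \<le> g t y"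
    show "x \<noteq> z" using xyz eqI by blast
    show "g t z \<le> g t x" for t using xyz order_trans by blast
  qed
  have sub: "parcs ?D \<subseteq> ?R" by (auto simp: dominance_digraph_def)
  have wf: "wf_digraph (with_proj ?D)"
    by unfold_locales (auto simp: dominance_digraph_def)
  have "\<not> pre_digraph.cycle (with_proj ?D) c" for c
  proof
    assume "pre_digraph.cycle (with_proj ?D) c"
    then obtain u where "pre_digraph.awalk (with_proj ?D) u c u" "c \<noteq> []"
      by (auto simp: pre_digraph.cycle_def)
    then have "(u, u) \<in> (parcs ?D)\<^sup>+"
      using wf_digraph.reachable1_awalkI[OF wf] by fastforce
    then have "(u, u) \<in> ?R\<^sup>+" using trancl_mono[OF _ sub] by blast
    then show False using trancl_id[OF trans_R] by auto
  qed
  moreover have "(p ! i, p ! j) \<in> parcs ?D"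
    if p: "vpath p (with_proj ?D)" and ij: "i < j" "j < length p"
      and end_arc: "(hd p, last p) \<in> parcs ?D \<or> (last p, hd p) \<in> parcs ?D" for p i j
  proof -
    have step: "(p ! n, p ! Suc n) \<in> parcs ?D" if "Suc n < length p" for n
      using p nth_Suc_in_vwalk_arcs[OF that] by (auto simp: vpath_def vwalk_def)
    have mono: "(p ! m, p ! n) \<in> ?R" if "m < n" "n < length p" for m n
      using that
    proof (induction n)
      case (Suc n)
      have "(p ! n, p ! Suc n) \<in> ?R" using step sub Suc.prems by blast
      moreover have "(p ! m, p ! n) \<in> ?R" if "m \<noteq> n" using Suc that by auto
      ultimately show ?case using transD[OF trans_R] by blast
    qed simp
    have hl: "hd p = p ! 0" "last p = p ! (length p - 1)"
      using p by (auto simp: vpath_def vwalk_def hd_conv_nth last_conv_nth)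
    have le: "g t (p ! n) \<le> g t (p ! m)" if "m \<le> n" "n < length p" for m n t
      using mono[of m n] that by (cases "m = n") auto
    \<comment> \<open>The path already descends from \<open>hd p\<close> to \<open>last p\<close> in
      \<open>?R\<close>, so an arc back would give a loop in \<open>?R\<close>. The arc between the
      ends thus points forward.\<close>
    have "(hd p, last p) \<in> ?R" unfolding hl using ij by (intro mono) auto
    moreover have "(hd p, hd p) \<notin> ?R" by simp
    ultimately have "(hd p, last p) \<in> parcs ?D"
      using end_arc sub transD[OF trans_R] by blast
    then have "g t (p ! 0) - g t (p ! (length p - 1)) \<le> 1" for t
      unfolding hl by (simp add: dominance_digraph_def)
    moreover have "g t (p ! i) \<le> g t (p ! 0)" "g t (p ! (length p - 1)) \<le> g t (p ! j)" for t
      using ij by (auto intro: le)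
    ultimately have "g t (p ! i) - g t (p ! j) \<le> 1" for t by (smt (verit))
    then show ?thesis using mono[OF ij] by (auto simp: dominance_digraph_def)
  qed
  ultimately show ?thesis unfolding semi_transitive_def by blast
qed

text \<open>The two disjuncts of \<open>alternate_iff_count_shift\<close> are the two directions of
  an edge; injectivity keeps both from holding at once.\<close>

lemma orientation_of_dominance_digraph:
  assumes "pair_graph G" and w: "set w = pverts G"
    and rep: "\<And>x y. x \<in> pverts G \<Longrightarrow> y \<in> pverts G \<Longrightarrow> x \<noteq> y \<Longrightarrow> alternate w x y \<longleftrightarrow> (x, y) \<in> parcs G"
  shows "orientation_of G (dominance_digraph (pverts G) (count_shift w s))"
proof -
  interpret pair_graph G by fact
  have "x \<in> pverts G \<and> y \<in> pverts G \<and> x \<noteq> y" if "(x, y) \<in> parcs G" for x y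
    using that in_arcsD1 in_arcsD2 no_loops' by auto
  then have "parcs G = {(x, y). x \<in> pverts G \<and> y \<in> pverts G \<and> x \<noteq> y \<and> alternate w x y}"
    using rep by auto
  moreover have "x = y" if "x \<in> pverts G" "y \<in> pverts G"
    "\<forall>t. 0 \<le> count_shift w s t x - count_shift w s t y"
    "\<forall>t. 0 \<le> count_shift w s t y - count_shift w s t x" for x y
    by (rule inj_onD[OF inj_on_count_shift[of w s]])
      (use that w in \<open>auto intro: order.antisym\<close>)
  ultimately show ?thesis
    unfolding orientation_of_def dominance_digraph_def
    by (auto simp: alternate_iff_count_shift[of _ _ w s])
qed

theorem theorem6:
  fixes G :: "'a pair_pre_digraph" and v :: 'a
  assumes "pair_graph G"
    and "word_representable G"
    and "v \<in> pverts G"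
  shows "(\<exists>D. orientation_of G D \<and> semi_transitive D \<and> source D v) \<and>
         (\<exists>D. orientation_of G D \<and> semi_transitive D \<and> sink D v)"
proof -
  obtain w where w: "set w = pverts G"
    and rep: "\<And>x y. x \<in> pverts G \<Longrightarrow> y \<in> pverts G \<Longrightarrow> x \<noteq> y \<Longrightarrow> alternate w x y \<longleftrightarrow> (x, y) \<in> parcs G"
    using assms(2) unfolding word_representable_def by blast
  let ?D = "\<lambda>s. dominance_digraph (pverts G) (count_shift w s)"
  have D: "orientation_of G (?D s) \<and> semi_transitive (?D s)" for s
    using orientation_of_dominance_digraph[OF assms(1) w rep]
      semi_transitive_dominance_digraph inj_on_count_shift[of w s] w by auto
  obtain i where i: "i < length w" "w ! i = v"
    using assms(3) w by (metis in_set_conv_nth)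
  \<comment> \<open>Only \<open>v\<close> is read between times \<open>i\<close> and
    \<open>Suc i\<close>. Shifting by one of them and evaluating at the other puts \<open>v\<close>
    strictly above, respectively below, all other vertices, so no arc enters, respectively leaves,
    \<open>v\<close>.\<close>
  have "count_shift w i (Suc i) x = (if x = v then 1 else 0)"
    "count_shift w (Suc i) i x = (if x = v then - 1 else 0)" for x
    using i by (auto simp: take_Suc_conv_app_nth count_shift_def)
  then have "(x, y) \<in> parcs (?D i) \<Longrightarrow> y \<noteq> v" "(x, y) \<in> parcs (?D (Suc i)) \<Longrightarrow> x \<noteq> v" for x y
    by (auto simp: dominance_digraph_def dest: spec[of _ i] spec[of _ "Suc i"])
  then have "source (?D i) v" "sink (?D (Suc i)) v"
    unfolding source_def sink_def by auto
  then show ?thesis using D by blast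
qed

end
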